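(* Let $a\neq 0$, $b$ and $\varepsilon$ be real constants and set $$\widetilde X=\sqrt{e^{\varepsilon}(1+X^2)-1},\qquad \widetilde Y=\frac{e^{\varepsilon/2}\,(3aY+bX)-(b+\varepsilon)\sqrt{e^{\varepsilon}(1+X^2)-1}}{3a},\qquad \widetilde b=b+\varepsilon .$$ Let $I\subset\mathbb{R}\setminus\{0\}$ be an open interval on which $e^{\varepsilon}(1+X^2)>1$, and let $Y:I\to\mathbb{R}$ be a $C^2$ function. Let $\widetilde I$ be the image of $I$ under $X\mapsto\widetilde X$, and regard $\widetilde Y$, evaluated along $Y=Y(X)$, as a function of $\widetilde X\in\widetilde I$. Then $Y$ satisfies $$X Y'' = \frac{b}{3a}+\frac{b^3}{27a^2}+\left(1+\frac{b^2}{3a}\right)Y' + b\,(Y')^2 + a\,(Y')^3$$ on $I$ if and only if $\widetilde Y$ satisfies $$\widetilde X\,\widetilde Y'' = \frac{\widetilde b}{3a}+\frac{\widetilde b^3}{27a^2}+\left(1+\frac{\widetilde b^2}{3a}\right)\widetilde Y' + \widetilde b\,(\widetilde Y')^2 + a\,(\widetilde Y')^3$$ on $\widetilde I$. In particular, for $\varepsilon=-b$, the point transformation $$\widetilde X=\sqrt{e^{-b}(1+X^2)-1},\qquad \widetilde Y=e^{-b/2}\left(Y+\frac{b}{3a}X\right)$$ transforms the first equation into $\widetilde X\,\widetilde Y''=\widetilde Y'+a\,(\widetilde Y')^3$ and vice versa.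
   Context: Primes on $Y$ denote derivatives with respect to $X$; primes on $\widetilde Y$ denote derivatives with respect to $\widetilde X$. On $I$ the map $X\mapsto\widetilde X$ is smooth and strictly monotone, so $\widetilde Y$ is a well-defined $C^2$ function of $\widetilde X$. All quantities are real. *)

theory Defs
  imports "HOL-Analysis.Analysis"
begin

definition C2_on :: "real set \<Rightarrow> (real \<Rightarrow> real) \<Rightarrow> bool" where
  "C2_on S f \<longleftrightarrow> f C1_differentiable_on S \<and> deriv f C1_differentiable_on S"

text \<open>
  Since deriv is total, being a solution includes twice continuous differentiability;
  the sets below are always open.
\<close>
definition solves_full :: "real \<Rightarrow> real \<Rightarrow> real set \<Rightarrow> (real \<Rightarrow> real) \<Rightarrow> bool" where
  "solves_full a b S f \<longleftrightarrow> C2_on S f \<and>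
     (\<forall>x\<in>S. x * deriv (deriv f) x =
        b / (3 * a) + b ^ 3 / (27 * a ^ 2) + (1 + b ^ 2 / (3 * a)) * deriv f x
          + b * (deriv f x) ^ 2 + a * (deriv f x) ^ 3)"

definition solves_reduced :: "real \<Rightarrow> real set \<Rightarrow> (real \<Rightarrow> real) \<Rightarrow> bool" where
  "solves_reduced a S f \<longleftrightarrow> C2_on S f \<and>
     (\<forall>x\<in>S. x * deriv (deriv f) x = deriv f x + a * (deriv f x) ^ 3)"

definition Xtilde :: "real \<Rightarrow> real \<Rightarrow> real" where
  "Xtilde \<epsilon> X = sqrt (exp \<epsilon> * (1 + X ^ 2) - 1)"

definition Ytilde :: "real \<Rightarrow> real \<Rightarrow> real \<Rightarrow> real \<Rightarrow> real \<Rightarrow> real" where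
  "Ytilde a b \<epsilon> X Y =
     (exp (\<epsilon> / 2) * (3 * a * Y + b * X) - (b + \<epsilon>) * sqrt (exp \<epsilon> * (1 + X ^ 2) - 1)) / (3 * a)"

text \<open>
  The point transformation (X, Y) to (\<xi> X, \<eta> X Y), applied to the graph of
  f over S. The result represents a function on \<xi> ` S and is meaningful only if \<xi> is
  injective on S.
\<close>
definition transform_graph ::
  "(real \<Rightarrow> real) \<Rightarrow> (real \<Rightarrow> real \<Rightarrow> real) \<Rightarrow> real set \<Rightarrow> (real \<Rightarrow> real) \<Rightarrow> real \<Rightarrow> real" where
  "transform_graph \<xi> \<eta> S f t = \<eta> (inv_into S \<xi> t) (f (inv_into S \<xi> t))"

lemma transform_graph_apply:
  "inj_on \<xi> S \<Longrightarrow> X \<in> S \<Longrightarrow> transform_graph \<xi> \<eta> S f (\<xi> X) = \<eta> X (f X)"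
  by (simp add: transform_graph_def)

lemma inj_on_Xtilde:
  assumes "is_interval S" and "0 \<notin> S"
  shows "inj_on (Xtilde \<epsilon>) S"
proof (rule inj_onI)
  fix x y :: real
  assume x: "x \<in> S" and y: "y \<in> S" and eq: "Xtilde \<epsilon> x = Xtilde \<epsilon> y"
  from eq have "x ^ 2 = y ^ 2" by (simp add: Xtilde_def)
  then consider "x = y" | "x = - y" by (auto simp: power2_eq_iff)
  then show "x = y"
  proof cases
    case 2
    have "x \<le> 0 \<and> 0 \<le> y \<or> y \<le> 0 \<and> 0 \<le> x" using 2 by linarith
    then have "0 \<in> S" using assms(1) x y unfolding is_interval_1 by blast
    with assms(2) show ?thesis by simp
  qed
qed

end

(* Completing the cube turns the full equation for Y into the reduced equation
   X U'' = U' + a (U')^3 for U = Y + (b / (3a)) X, and under this substitution the point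
   transformation becomes simply U \<mapsto> exp (\<epsilon> / 2) U along with the change of the independent variable X.
   The latter is a symmetry of the reduced equation, since d(Xtilde^2) = exp \<epsilon> d(X^2). *)

theory Submission
  imports Defs
begin

section \<open>Twice continuous differentiability through explicit derivatives\<close>

lemma DERIV_imp_continuous_on:
  fixes f :: "real \<Rightarrow> real"
  assumes "\<And>x. x \<in> S \<Longrightarrow> (f has_real_derivative D x) (at x)"
  shows "continuous_on S f"
  by (meson assms DERIV_isCont continuous_at_imp_continuous_on)

lemma C2_onI:
  assumes "open S"
    and f: "\<And>x. x \<in> S \<Longrightarrow> (f has_real_derivative f1 x) (at x)"
    and f1: "\<And>x. x \<in> S \<Longrightarrow> (f1 has_real_derivative f2 x) (at x)"
    and f2: "continuous_on S f2"
  shows "C2_on S f"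
    and "\<And>x. x \<in> S \<Longrightarrow> deriv f x = f1 x"
    and "\<And>x. x \<in> S \<Longrightarrow> deriv (deriv f) x = f2 x"
proof -
  show d1: "deriv f x = f1 x" if "x \<in> S" for x
    using f[OF that] by (rule DERIV_imp_deriv)
  \<comment> \<open>\<open>deriv f\<close> is known to equal \<open>f1\<close> only on
    \<open>S\<close>; since \<open>S\<close> is open, they agree near \<open>x\<close>, which is
    what transferring a derivative requires.\<close>
  have D: "(deriv f has_real_derivative f2 x) (at x)" if "x \<in> S" for x
    using DERIV_cong_ev[OF refl _ refl, of "deriv f" f1 x "f2 x"] f1[OF that]
      eventually_nhds_in_open[OF \<open>open S\<close> that]
    by (metis (mono_tags, lifting) d1 eventually_mono)
  show "deriv (deriv f) x = f2 x" if "x \<in> S" for x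
    using D[OF that] by (rule DERIV_imp_deriv)
  have "continuous_on S f1"
    by (rule DERIV_imp_continuous_on) (rule f1)
  then show "C2_on S f"
    using f D f2 unfolding C2_on_def C1_differentiable_on_def
      has_real_derivative_iff_has_vector_derivative by (intro conjI exI[of _ f1] exI[of _ f2]) auto
qed

text \<open>\<open>C1_differentiable_on\<close> only asserts that some continuous derivative exists;
  uniqueness of derivatives identifies it with \<open>deriv\<close>.\<close>

lemma C2_onE:
  assumes "open S" "C2_on S f"
  shows "\<And>x. x \<in> S \<Longrightarrow> (f has_real_derivative deriv f x) (at x)"
    and "\<And>x. x \<in> S \<Longrightarrow> (deriv f has_real_derivative deriv (deriv f) x) (at x)"
    and "continuous_on S (deriv (deriv f))"
proof -
  have *: "(\<forall>x\<in>S. (g has_real_derivative deriv g x) (at x)) \<and> continuous_on S (deriv g)"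
    if C1: "g C1_differentiable_on S" for g :: "real \<Rightarrow> real"
  proof -
    obtain D where D: "\<And>x. x \<in> S \<Longrightarrow> (g has_real_derivative D x) (at x)" "continuous_on S D"
      using C1 by (auto simp: C1_differentiable_on_def has_real_derivative_iff_has_vector_derivative)
    then have "\<And>x. x \<in> S \<Longrightarrow> deriv g x = D x"
      by (blast intro: DERIV_imp_deriv)
    with D show ?thesis
      by (metis continuous_on_cong)
  qed
  show "\<And>x. x \<in> S \<Longrightarrow> (f has_real_derivative deriv f x) (at x)"
    "\<And>x. x \<in> S \<Longrightarrow> (deriv f has_real_derivative deriv (deriv f) x) (at x)"
    "continuous_on S (deriv (deriv f))"
    using assms(2) *[of f] *[of "deriv f"] by (auto simp: C2_on_def)
qed

lemma has_real_derivative_cong_on_open: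
  assumes "open S" "x \<in> S" "\<And>y. y \<in> S \<Longrightarrow> f y = g y" "(f has_real_derivative D) (at x)"
  shows "(g has_real_derivative D) (at x)"
  using assms has_field_derivative_transform_within_open by blast

section \<open>The reduced equation and its relation to the full one\<close>

lemma solves_reducedI:
  assumes "open S"
    and "\<And>x. x \<in> S \<Longrightarrow> (f has_real_derivative f1 x) (at x)"
    and "\<And>x. x \<in> S \<Longrightarrow> (f1 has_real_derivative f2 x) (at x)"
    and "continuous_on S f2"
    and "\<And>x. x \<in> S \<Longrightarrow> x * f2 x = f1 x + a * f1 x ^ 3"
  shows "solves_reduced a S f"
  using C2_onI[OF assms(1-4)] assms(5) by (simp add: solves_reduced_def)

text \<open>On an open set derivatives depend only on the values there. This matters because the
  transformed function is prescribed only on the image of the interval.\<close>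

lemma solves_reduced_cong:
  assumes "open S" "\<And>x. x \<in> S \<Longrightarrow> f x = g x"
  shows "solves_reduced a S f \<longleftrightarrow> solves_reduced a S g"
proof -
  have "solves_reduced a S g" if "solves_reduced a S f" "\<And>x. x \<in> S \<Longrightarrow> f x = g x" for f g
  proof -
    have "C2_on S f" and eq: "\<And>x. x \<in> S \<Longrightarrow> x * deriv (deriv f) x = deriv f x + a * deriv f x ^ 3"
      using that(1) by (auto simp: solves_reduced_def)
    note D = C2_onE[OF \<open>open S\<close> this(1)]
    show ?thesis
      by (rule solves_reducedI[OF \<open>open S\<close>
            has_real_derivative_cong_on_open[OF \<open>open S\<close> _ that(2) D(1)] D(2) D(3) eq])
  qed
  from this[of f g] this[of g f] assms(2) show ?thesis by auto
qed

text \<open>With \<open>c = b / (3 * a)\<close> the coefficients other than the summand 1 are those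
  of \<open>a * (p + c) ^ 3\<close>: constant \<open>a * c ^ 3\<close>, then
  \<open>3 * a * c ^ 2\<close> and \<open>3 * a * c = b\<close>. The remaining \<open>p + c\<close>
  accounts for \<open>b / (3 * a)\<close> and the 1.\<close>

lemma cube_completion:
  fixes a b p :: real
  assumes "a \<noteq> 0"
  shows "b / (3 * a) + b ^ 3 / (27 * a ^ 2) + (1 + b ^ 2 / (3 * a)) * p + b * p ^ 2 + a * p ^ 3 =
    (p + b / (3 * a)) + a * (p + b / (3 * a)) ^ 3"
proof -
  define c where "c = b / (3 * a)"
  then have b: "b = 3 * a * c"
    using assms by simp
  have "b ^ 3 / (27 * a ^ 2) = a * c ^ 3" "b ^ 2 / (3 * a) = 3 * a * c ^ 2"
    using assms by (simp_all add: b power2_eq_square power3_eq_cube)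
  then show ?thesis
    unfolding c_def[symmetric] by (simp add: b power2_eq_square power3_eq_cube algebra_simps)
qed

text \<open>Adding \<open>c * x\<close> shifts the first derivative by \<open>c\<close> and leaves
  the second unchanged, so the left-hand sides agree and \<open>cube_completion\<close> matches the
  right-hand sides.\<close>

lemma solves_full_iff_reduced:
  assumes "a \<noteq> 0" "open S"
  shows "solves_full a b S f \<longleftrightarrow> solves_reduced a S (\<lambda>x. f x + b / (3 * a) * x)"
proof -
  have shift: "C2_on S (\<lambda>x. f x + c * x) \<and>
      (\<forall>x\<in>S. deriv (\<lambda>x. f x + c * x) x = deriv f x + c
        \<and> deriv (deriv (\<lambda>x. f x + c * x)) x = deriv (deriv f) x)"
    if "C2_on S f" for f and c :: real
  proof -
    note D = C2_onE[OF \<open>open S\<close> that]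
    have 1: "((\<lambda>x. f x + c * x) has_real_derivative deriv f x + c) (at x)" if "x \<in> S" for x
      by (auto intro!: derivative_eq_intros D(1) that)
    have 2: "((\<lambda>x. deriv f x + c) has_real_derivative deriv (deriv f) x) (at x)" if "x \<in> S" for x
      by (auto intro!: derivative_eq_intros D(2) that)
    show ?thesis
      using C2_onI[OF \<open>open S\<close> 1 2 D(3)] by blast
  qed
  \<comment> \<open>Regularity passes back by shifting with the opposite slope.\<close>
  have "C2_on S f" if "C2_on S (\<lambda>x. f x + b / (3 * a) * x)"
    using shift[OF that, of "- (b / (3 * a))"] by simp
  then show ?thesis
    using shift[of f "b / (3 * a)"]
    by (auto simp: solves_full_def solves_reduced_def cube_completion[OF \<open>a \<noteq> 0\<close>])
qed

text \<open>The hypothesis on \<open>g\<close> says that \<open>g ^ 2\<close> has derivative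
  \<open>2 * m * x\<close>. The chain rule then multiplies t F'' - F' by
  \<open>k * m ^ 2 * (x / g x) ^ 3\<close> and the cube of F' by
  \<open>k ^ 3 * m ^ 3 * (x / g x) ^ 3\<close>; these factors agree because
  \<open>k ^ 2 * m = 1\<close>. Stated for general \<open>m\<close> and \<open>k\<close>, it serves
  both \<open>Xtilde\<close> and its inverse.\<close>

lemma solves_reduced_compose:
  fixes g :: "real \<Rightarrow> real"
  assumes F: "solves_reduced a T F" and "open S" "open T"
    and g: "\<And>x. x \<in> S \<Longrightarrow> g x \<in> T" "\<And>x. x \<in> S \<Longrightarrow> g x \<noteq> 0"
    and g': "\<And>x. x \<in> S \<Longrightarrow> (g has_real_derivative m * x / g x) (at x)"
    and mk: "k ^ 2 * m = 1"
  shows "solves_reduced a S (\<lambda>x. k * F (g x))"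
proof -
  define F1 F2 where "F1 = deriv F" and "F2 = deriv (deriv F)"
  have C2: "C2_on T F" and eq: "\<And>t. t \<in> T \<Longrightarrow> t * F2 t = F1 t + a * F1 t ^ 3"
    using F by (auto simp: solves_reduced_def F1_def F2_def)
  note D = C2_onE[OF \<open>open T\<close> C2, folded F1_def F2_def]
  \<comment> \<open>First and second derivatives of \<open>k * F (g x)\<close>; the last bracket in
    \<open>V2\<close> is the derivative of \<open>x / g x\<close>.\<close>
  define V1 where "V1 = (\<lambda>x. k * m * (F1 (g x) * (x / g x)))"
  define V2 where "V2 = (\<lambda>x. k * m *
    (F2 (g x) * (m * x / g x) * (x / g x) + F1 (g x) * (1 / g x - m * x ^ 2 / g x ^ 3)))"
  show ?thesis
  proof (rule solves_reducedI[OF \<open>open S\<close>, where ?f1.0 = V1 and ?f2.0 = V2])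
    fix x assume x: "x \<in> S"
    have DF: "((\<lambda>x. F (g x)) has_real_derivative F1 (g x) * (m * x / g x)) (at x)"
      using DERIV_chain2[OF D(1)[OF g(1)[OF x]] g'[OF x]] .
    show "((\<lambda>x. k * F (g x)) has_real_derivative V1 x) (at x)"
      using DERIV_cmult[OF DF, of k] by (simp add: V1_def mult_ac)
    have DF1: "((\<lambda>x. F1 (g x)) has_real_derivative F2 (g x) * (m * x / g x)) (at x)"
      using DERIV_chain2[OF D(2)[OF g(1)[OF x]] g'[OF x]] .
    have DQ: "((\<lambda>x. x / g x) has_real_derivative 1 / g x - m * x ^ 2 / g x ^ 3) (at x)"
      by (rule derivative_eq_intros g'[OF x] g(2)[OF x] refl)+
        (use g(2)[OF x] in \<open>simp add: field_simps power2_eq_square power3_eq_cube\<close>)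
    show "(V1 has_real_derivative V2 x) (at x)"
      using DERIV_cmult[OF DERIV_mult[OF DF1 DQ], of "k * m"]
      by (simp add: V1_def V2_def mult_ac add_ac)
    have V1x: "V1 x ^ 3 = (k * m ^ 2 * (x / g x) ^ 3) * F1 (g x) ^ 3"
    proof -
      have "V1 x ^ 3 = (k ^ 2 * m) * (k * m ^ 2 * (x / g x) ^ 3) * F1 (g x) ^ 3"
        by (simp add: V1_def power_mult_distrib power2_eq_square power3_eq_cube)
      then show ?thesis using mk by simp
    qed
    \<comment> \<open>The \<open>1 / g x\<close> term of \<open>V2\<close>, multiplied by
      \<open>x\<close>, cancels \<open>V1 x\<close>; a common factor splits off the rest.\<close>
    have "x * V2 x - V1 x = k * m ^ 2 * (x / g x) ^ 3 * (g x * F2 (g x) - F1 (g x))"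
      using g(2)[OF x] by (simp add: V1_def V2_def field_simps power2_eq_square power3_eq_cube)
    also have "\<dots> = a * V1 x ^ 3"
      using eq[OF g(1)[OF x]] by (simp add: V1x algebra_simps)
    finally show "x * V2 x = V1 x + a * V1 x ^ 3" by simp
  next
    have contg: "continuous_on S g"
      by (rule DERIV_imp_continuous_on) (rule g')
    have "continuous_on T F1"
      by (rule DERIV_imp_continuous_on) (rule D(2))
    then have "continuous_on S (\<lambda>x. F1 (g x))" "continuous_on S (\<lambda>x. F2 (g x))"
      using D(3) g(1) by (auto intro: continuous_on_compose2[OF _ contg])
    then show "continuous_on S V2"
      unfolding V2_def using contg g(2) by (auto intro!: continuous_intros)
  qed
qed

section \<open>The change of the independent variable and its inverse\<close>

lemma Xtilde_pos: "exp \<epsilon> * (1 + X ^ 2) > 1 \<Longrightarrow> Xtilde \<epsilon> X > 0"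
  by (simp add: Xtilde_def)

lemma DERIV_Xtilde:
  assumes "exp \<epsilon> * (1 + X ^ 2) > 1"
  shows "(Xtilde \<epsilon> has_real_derivative exp \<epsilon> * X / Xtilde \<epsilon> X) (at X)"
proof -
  have "((\<lambda>X. exp \<epsilon> * (1 + X ^ 2) - 1) has_real_derivative exp \<epsilon> * (2 * X)) (at X)"
    by (auto intro!: derivative_eq_intros)
  from DERIV_chain2[OF DERIV_real_sqrt this] assms show ?thesis
    unfolding Xtilde_def[abs_def] by (simp add: inverse_eq_divide)
qed

context
  fixes \<epsilon> :: real and I :: "real set"
  assumes I: "open I" "is_interval I" "0 \<notin> I"
    and gt1: "\<And>X. X \<in> I \<Longrightarrow> exp \<epsilon> * (1 + X ^ 2) > 1"
begin

lemma continuous_on_Xtilde: "continuous_on I (Xtilde \<epsilon>)"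
  by (rule DERIV_imp_continuous_on) (rule DERIV_Xtilde[OF gt1])

lemma open_Xtilde_image: "open (Xtilde \<epsilon> ` I)"
  using invariance_of_domain[OF continuous_on_Xtilde I(1) inj_on_Xtilde[OF I(2,3)]] .

text \<open>By the inverse function theorem the derivative is the reciprocal of
  \<open>exp \<epsilon> * X / t\<close> at the preimage \<open>X\<close> of \<open>t\<close>. It has
  the same shape with \<open>\<epsilon>\<close> negated, as \<open>solves_reduced_compose\<close>
  requires.\<close>

lemma DERIV_inv_Xtilde:
  assumes "t \<in> Xtilde \<epsilon> ` I"
  shows "(inv_into I (Xtilde \<epsilon>) has_real_derivative exp (- \<epsilon>) * t / inv_into I (Xtilde \<epsilon>) t) (at t)"
proof -
  let ?g = "inv_into I (Xtilde \<epsilon>)"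
  have gI: "?g t \<in> I" and fg: "Xtilde \<epsilon> (?g t) = t"
    using assms by (simp_all add: inv_into_into f_inv_into_f)
  then have nz: "?g t \<noteq> 0" "t \<noteq> 0"
    using I Xtilde_pos[OF gt1[OF gI]] by auto
  have "(?g has_real_derivative inverse (exp \<epsilon> * ?g t / Xtilde \<epsilon> (?g t))) (at t)"
    unfolding has_field_derivative_def
  proof (rule has_derivative_inverse_strong_x[where g = ?g, OF \<open>open I\<close> gI continuous_on_Xtilde _ _ _ fg])
    show "?g (Xtilde \<epsilon> X) = X" if "X \<in> I" for X
      using inv_into_f_f[OF inj_on_Xtilde[OF I(2,3)] that] .
    show "(Xtilde \<epsilon> has_derivative (*) (exp \<epsilon> * ?g t / Xtilde \<epsilon> (?g t))) (at (?g t))"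
      using DERIV_Xtilde[OF gt1[OF gI]] by (simp add: has_field_derivative_def)
  qed (use nz fg in \<open>auto simp: fun_eq_iff\<close>)
  then show ?thesis
    by (simp add: fg exp_minus field_simps)
qed

section \<open>The symmetry of the reduced equation\<close>

lemma solves_reduced_pullback:
  assumes "solves_reduced a (Xtilde \<epsilon> ` I) W"
  shows "solves_reduced a I (\<lambda>X. exp (- \<epsilon> / 2) * W (Xtilde \<epsilon> X))"
proof (rule solves_reduced_compose[OF assms \<open>open I\<close> open_Xtilde_image _ _ DERIV_Xtilde[OF gt1]])
  \<comment> \<open>\<open>DERIV_Xtilde\<close> gives \<open>m = exp \<epsilon>\<close>, which
    forces this scaling \<open>k\<close> up to sign.\<close>
  show "exp (- \<epsilon> / 2) ^ 2 * exp \<epsilon> = 1"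
    by (simp flip: exp_double exp_add)
  show "Xtilde \<epsilon> X \<noteq> 0" if "X \<in> I" for X
    using Xtilde_pos[OF gt1[OF that]] by simp
qed auto

text \<open>The inverse change of variable has \<open>m = exp (- \<epsilon>)\<close>, hence
  \<open>k = exp (\<epsilon> / 2)\<close>; it does not vanish because its values lie in
  \<open>I\<close>.\<close>

lemma solves_reduced_pushforward:
  assumes "solves_reduced a I U"
  shows "solves_reduced a (Xtilde \<epsilon> ` I) (\<lambda>t. exp (\<epsilon> / 2) * U (inv_into I (Xtilde \<epsilon>) t))"
proof (rule solves_reduced_compose[OF assms open_Xtilde_image \<open>open I\<close> _ _ DERIV_inv_Xtilde])
  show "exp (\<epsilon> / 2) ^ 2 * exp (- \<epsilon>) = 1"
    by (simp flip: exp_double exp_add)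
  show inI: "inv_into I (Xtilde \<epsilon>) t \<in> I" if "t \<in> Xtilde \<epsilon> ` I" for t
    using that by (rule inv_into_into)
  show "inv_into I (Xtilde \<epsilon>) t \<noteq> 0" if "t \<in> Xtilde \<epsilon> ` I" for t
    using inI[OF that] I(3) by metis
qed

text \<open>On the image \<open>W\<close> equals the pushforward of \<open>U\<close>, and on
  \<open>I\<close> the function \<open>U\<close> equals the pullback of \<open>W\<close>. Leaving
  \<open>W\<close> arbitrary covers both transformed graphs and given solutions on the
  image.\<close>

lemma solves_reduced_iff_transform:
  assumes W: "\<And>X. X \<in> I \<Longrightarrow> W (Xtilde \<epsilon> X) = exp (\<epsilon> / 2) * U X"
  shows "solves_reduced a I U \<longleftrightarrow> solves_reduced a (Xtilde \<epsilon> ` I) W"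
proof
  assume "solves_reduced a I U"
  have "W t = exp (\<epsilon> / 2) * U (inv_into I (Xtilde \<epsilon>) t)" if "t \<in> Xtilde \<epsilon> ` I" for t
    using W[of "inv_into I (Xtilde \<epsilon>) t"] that by (simp add: inv_into_into f_inv_into_f)
  from solves_reduced_cong[OF open_Xtilde_image this] show "solves_reduced a (Xtilde \<epsilon> ` I) W"
    using solves_reduced_pushforward[OF \<open>solves_reduced a I U\<close>] by simp
next
  assume "solves_reduced a (Xtilde \<epsilon> ` I) W"
  have "U X = exp (- \<epsilon> / 2) * W (Xtilde \<epsilon> X)" if "X \<in> I" for X
    by (simp add: W[OF that] flip: exp_add mult.assoc)
  from solves_reduced_cong[OF \<open>open I\<close> this] show "solves_reduced a I U"
    using solves_reduced_pullback[OF \<open>solves_reduced a (Xtilde \<epsilon> ` I) W\<close>] by simp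
qed

lemma solves_full_iff_transform:
  assumes "a \<noteq> 0"
  shows "solves_full a b I Y \<longleftrightarrow>
    solves_full a (b + \<epsilon>) (Xtilde \<epsilon> ` I) (transform_graph (Xtilde \<epsilon>) (Ytilde a b \<epsilon>) I Y)"
  unfolding solves_full_iff_reduced[OF assms \<open>open I\<close>]
    solves_full_iff_reduced[OF assms open_Xtilde_image]
proof (rule solves_reduced_iff_transform)
  fix X assume "X \<in> I"
  have "transform_graph (Xtilde \<epsilon>) (Ytilde a b \<epsilon>) I Y (Xtilde \<epsilon> X) = Ytilde a b \<epsilon> X (Y X)"
    by (rule transform_graph_apply[OF inj_on_Xtilde[OF I(2,3)] \<open>X \<in> I\<close>])
  \<comment> \<open>The shift completing the cube for \<open>b + \<epsilon>\<close> cancels the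
    square-root term of \<open>Ytilde\<close>, leaving the scaled shift for
    \<open>b\<close>.\<close>
  then show "transform_graph (Xtilde \<epsilon>) (Ytilde a b \<epsilon>) I Y (Xtilde \<epsilon> X) + (b + \<epsilon>) / (3 * a) * Xtilde \<epsilon> X
      = exp (\<epsilon> / 2) * (Y X + b / (3 * a) * X)"
    unfolding Ytilde_def Xtilde_def[symmetric] using assms by (simp add: field_simps)
qed

text \<open>Meant for \<open>\<epsilon> = - b\<close>: the new parameter
  \<open>b + \<epsilon>\<close> is then 0, so the target needs no further shift.\<close>

lemma solves_full_iff_solves_reduced_transform:
  assumes "a \<noteq> 0"
    and W: "\<And>X. X \<in> I \<Longrightarrow> W (Xtilde \<epsilon> X) = exp (\<epsilon> / 2) * (Y X + b / (3 * a) * X)"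
  shows "solves_full a b I Y \<longleftrightarrow> solves_reduced a (Xtilde \<epsilon> ` I) W"
  unfolding solves_full_iff_reduced[OF \<open>a \<noteq> 0\<close> \<open>open I\<close>]
  using W by (rule solves_reduced_iff_transform)

end

section \<open>The equivalence for general \<open>\<epsilon>\<close> and the reduction at
  \<open>\<epsilon> = - b\<close>\<close>

theorem mainTheorem2:
  fixes a b \<epsilon> :: real
  assumes "a \<noteq> 0"
  shows
    "(\<forall>(I :: real set) (Y :: real \<Rightarrow> real).
        open I \<and> is_interval I \<and> 0 \<notin> I \<and> (\<forall>X\<in>I. exp \<epsilon> * (1 + X ^ 2) > 1) \<and> C2_on I Y \<longrightarrow>
        (solves_full a b I Y \<longleftrightarrow>
         solves_full a (b + \<epsilon>) (Xtilde \<epsilon> ` I)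
           (transform_graph (Xtilde \<epsilon>) (Ytilde a b \<epsilon>) I Y)))
     \<and>
     (let \<xi> = (\<lambda>X. sqrt (exp (- b) * (1 + X ^ 2) - 1));
          \<eta> = (\<lambda>X Y. exp (- b / 2) * (Y + b / (3 * a) * X))
      in \<forall>I :: real set.
           open I \<and> is_interval I \<and> 0 \<notin> I \<and> (\<forall>X\<in>I. exp (- b) * (1 + X ^ 2) > 1) \<longrightarrow>
           (\<forall>Y :: real \<Rightarrow> real. C2_on I Y \<longrightarrow>
              (solves_full a b I Y \<longleftrightarrow>
               solves_reduced a (\<xi> ` I) (transform_graph \<xi> \<eta> I Y)))
           \<and> (\<forall>W :: real \<Rightarrow> real. solves_reduced a (\<xi> ` I) W \<longrightarrow>
               (\<exists>Y. solves_full a b I Y \<and> (\<forall>X\<in>I. W (\<xi> X) = \<eta> X (Y X)))))"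
proof (rule conjI)
  show "\<forall>(I :: real set) (Y :: real \<Rightarrow> real).
        open I \<and> is_interval I \<and> 0 \<notin> I \<and> (\<forall>X\<in>I. exp \<epsilon> * (1 + X ^ 2) > 1) \<and> C2_on I Y \<longrightarrow>
        (solves_full a b I Y \<longleftrightarrow>
         solves_full a (b + \<epsilon>) (Xtilde \<epsilon> ` I)
           (transform_graph (Xtilde \<epsilon>) (Ytilde a b \<epsilon>) I Y))"
  proof (intro allI impI, elim conjE)
    fix I Y
    assume "open I" "is_interval I" "0 \<notin> I" "\<forall>X\<in>I. exp \<epsilon> * (1 + X ^ 2) > 1"
    then show "solves_full a b I Y \<longleftrightarrow>
        solves_full a (b + \<epsilon>) (Xtilde \<epsilon> ` I) (transform_graph (Xtilde \<epsilon>) (Ytilde a b \<epsilon>) I Y)"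
      by (intro solves_full_iff_transform assms) blast+
  qed
next
  \<comment> \<open>This is \<open>Ytilde a b (- b)\<close>, whose square-root term has coefficient
    0.\<close>
  define \<eta> where "\<eta> = (\<lambda>X Y. exp (- b / 2) * (Y + b / (3 * a) * X))"
  have main: "(\<forall>Y. C2_on I Y \<longrightarrow>
          (solves_full a b I Y \<longleftrightarrow>
           solves_reduced a (Xtilde (- b) ` I) (transform_graph (Xtilde (- b)) \<eta> I Y)))
      \<and> (\<forall>W. solves_reduced a (Xtilde (- b) ` I) W \<longrightarrow>
          (\<exists>Y. solves_full a b I Y \<and> (\<forall>X\<in>I. W (Xtilde (- b) X) = \<eta> X (Y X))))"
    if I: "open I" "is_interval I" "0 \<notin> I" and gt1: "\<And>X. X \<in> I \<Longrightarrow> exp (- b) * (1 + X ^ 2) > 1"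
    for I
  proof (intro conjI allI impI)
    fix Y
    show "solves_full a b I Y \<longleftrightarrow>
        solves_reduced a (Xtilde (- b) ` I) (transform_graph (Xtilde (- b)) \<eta> I Y)"
      by (rule solves_full_iff_solves_reduced_transform[OF I gt1 assms])
        (simp_all add: transform_graph_apply[OF inj_on_Xtilde[OF I(2,3)]] \<eta>_def)
  next
    fix W assume W: "solves_reduced a (Xtilde (- b) ` I) W"
    \<comment> \<open>Obtained by solving \<open>W (Xtilde (- b) X) = \<eta> X (Y X)\<close> for
      \<open>Y X\<close>; its regularity follows from the equivalence below.\<close>
    define Y where "Y = (\<lambda>X. exp (b / 2) * W (Xtilde (- b) X) - b / (3 * a) * X)"
    have eq: "W (Xtilde (- b) X) = \<eta> X (Y X)" for X
      by (simp add: \<eta>_def Y_def flip: exp_add mult.assoc)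
    have "solves_full a b I Y \<longleftrightarrow> solves_reduced a (Xtilde (- b) ` I) W"
      by (rule solves_full_iff_solves_reduced_transform[OF I gt1 assms]) (simp_all add: eq \<eta>_def)
    with W eq show "\<exists>Y. solves_full a b I Y \<and> (\<forall>X\<in>I. W (Xtilde (- b) X) = \<eta> X (Y X))"
      by blast
  qed
  have \<xi>: "(\<lambda>X. sqrt (exp (- b) * (1 + X ^ 2) - 1)) = Xtilde (- b)"
    by (simp add: fun_eq_iff Xtilde_def)
  show "let \<xi> = (\<lambda>X. sqrt (exp (- b) * (1 + X ^ 2) - 1));
          \<eta> = (\<lambda>X Y. exp (- b / 2) * (Y + b / (3 * a) * X))
      in \<forall>I :: real set.
           open I \<and> is_interval I \<and> 0 \<notin> I \<and> (\<forall>X\<in>I. exp (- b) * (1 + X ^ 2) > 1) \<longrightarrow>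
           (\<forall>Y :: real \<Rightarrow> real. C2_on I Y \<longrightarrow>
              (solves_full a b I Y \<longleftrightarrow>
               solves_reduced a (\<xi> ` I) (transform_graph \<xi> \<eta> I Y)))
           \<and> (\<forall>W :: real \<Rightarrow> real. solves_reduced a (\<xi> ` I) W \<longrightarrow>
               (\<exists>Y. solves_full a b I Y \<and> (\<forall>X\<in>I. W (\<xi> X) = \<eta> X (Y X))))"
    unfolding Let_def \<eta>_def[symmetric] \<xi>
    by (intro allI impI, elim conjE, rule main) blast+
qed

end
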